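(* Let $n\ge1$. The set $SE_n$ listed in Co-Reflected Gray Code order $\prec_c$ is a $1$-Gray code: consecutive sequences in the list differ in at most one position.
   Context: $SE_n$ is the set of sequences $s_1\ldots s_n$ of non-negative integers with $s_1=0$ and $0\le s_{k+1}\le k$ for $1\le k<n$. Co-Reflected Gray Code order on length-$n$ sequences: $s\prec_c t$ if, with $k$ the rightmost position where $s$ and $t$ differ, either $\sum_{i=k+1}^n s_i+(n-k)$ is even and $s_k>t_k$, or $\sum_{i=k+1}^n s_i+(n-k)$ is odd and $s_k<t_k$. A list is a $d$-Gray code if the Hamming distance between consecutive sequences is at most $d$. *)

theory Defs
  imports Main
begin

text \<open>
  A sequence \<open>s\<^sub>1 \<dots> s\<^sub>n\<close> is represented by a list of length \<open>n\<close>; as list positions start at 0,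
  \<open>s\<^sub>k\<close> is \<open>s ! (k - 1)\<close>.
\<close>

definition SE :: "nat \<Rightarrow> nat list set" where
  "SE n = {s. length s = n \<and> s ! 0 = 0 \<and> (\<forall>k. 1 \<le> k \<and> k < n \<longrightarrow> s ! k \<le> k)}"

text \<open>
  The rightmost position where the sequences differ is \<open>k = Suc j\<close>, so that \<open>n - k\<close> is
  \<open>length s - Suc j\<close>.
\<close>

definition co_rgc_less :: "nat list \<Rightarrow> nat list \<Rightarrow> bool" (infix "\<prec>\<^sub>c" 50) where
  "s \<prec>\<^sub>c t \<longleftrightarrow> length s = length t \<and>
    (\<exists>j < length s. s ! j \<noteq> t ! j \<and> (\<forall>i. j < i \<and> i < length s \<longrightarrow> s ! i = t ! i) \<and>
      (even ((\<Sum>i\<in>{j<..<length s}. s ! i) + (length s - Suc j)) \<and> s ! j > t ! j \<or>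
       odd ((\<Sum>i\<in>{j<..<length s}. s ! i) + (length s - Suc j)) \<and> s ! j < t ! j))"

definition is_listing :: "('a \<Rightarrow> 'a \<Rightarrow> bool) \<Rightarrow> 'a set \<Rightarrow> 'a list \<Rightarrow> bool" where
  "is_listing r S L \<longleftrightarrow> set L = S \<and> distinct L \<and> sorted_wrt r L"

text \<open>Only used for sequences of equal length.\<close>

definition hamming_dist :: "'a list \<Rightarrow> 'a list \<Rightarrow> nat" where
  "hamming_dist s t = card {i. i < length s \<and> s ! i \<noteq> t ! i}"

definition gray_code :: "nat \<Rightarrow> 'a list list \<Rightarrow> bool" where
  "gray_code d L \<longleftrightarrow> successively (\<lambda>s t. hamming_dist s t \<le> d) L"

text \<open>
  On sequences of equal length \<open>\<prec>\<^sub>c\<close> is a strict linear order, hence \<open>SE n\<close> has exactly one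
  listing in this order.
\<close>

lemma co_rgc_less_irrefl: "\<not> s \<prec>\<^sub>c s"
  by (simp add: co_rgc_less_def)

lemma co_rgc_less_trans:
  assumes "s \<prec>\<^sub>c t" "t \<prec>\<^sub>c u"
  shows "s \<prec>\<^sub>c u"
proof -
  define n where "n = length s"
  define P where "P v j = even ((\<Sum>i\<in>{j<..<n}. v ! i) + (n - Suc j))" for v :: "nat list" and j
  have len: "length t = n" "length u = n"
    using assms by (auto simp: co_rgc_less_def n_def)
  obtain j where j: "j < n" "s ! j \<noteq> t ! j" "\<And>i. j < i \<Longrightarrow> i < n \<Longrightarrow> s ! i = t ! i"
    "P s j \<and> s ! j > t ! j \<or> \<not> P s j \<and> s ! j < t ! j"
    using assms(1) len unfolding co_rgc_less_def P_def n_def by metis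
  obtain k where k: "k < n" "t ! k \<noteq> u ! k" "\<And>i. k < i \<Longrightarrow> i < n \<Longrightarrow> t ! i = u ! i"
    "P t k \<and> t ! k > u ! k \<or> \<not> P t k \<and> t ! k < u ! k"
    using assms(2) len unfolding co_rgc_less_def P_def by metis
  have P_cong: "P s m = P t m" if "m \<ge> j" for m
  proof -
    have "(\<Sum>i\<in>{m<..<n}. s ! i) = (\<Sum>i\<in>{m<..<n}. t ! i)"
      using j(3) that by (intro sum.cong) auto
    thus ?thesis by (simp add: P_def)
  qed
  have "\<exists>m<n. s ! m \<noteq> u ! m \<and> (\<forall>i. m < i \<and> i < n \<longrightarrow> s ! i = u ! i) \<and>
          (P s m \<and> s ! m > u ! m \<or> \<not> P s m \<and> s ! m < u ! m)"
  proof (cases j k rule: linorder_cases)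
    case less
    thus ?thesis using j k P_cong[of k] by (intro exI[of _ k]) auto
  next
    case equal
    thus ?thesis using j k P_cong[of k] by (intro exI[of _ k]) auto
  next
    case greater
    thus ?thesis using j k by (intro exI[of _ j]) auto
  qed
  thus ?thesis using len by (auto simp: co_rgc_less_def P_def n_def)
qed

lemma co_rgc_less_total:
  assumes "length s = length t" "s \<noteq> t"
  shows "s \<prec>\<^sub>c t \<or> t \<prec>\<^sub>c s"
proof -
  define D where "D = {i. i < length s \<and> s ! i \<noteq> t ! i}"
  define j where "j = Max D"
  have fin: "finite D" by (simp add: D_def)
  have "D \<noteq> {}" using assms by (auto simp: D_def list_eq_iff_nth_eq)
  with fin have "j \<in> D" unfolding j_def by (rule Max_in)
  hence j: "j < length s" "s ! j \<noteq> t ! j" by (auto simp: D_def)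
  have eq: "s ! i = t ! i" if "j < i" "i < length s" for i
  proof (rule ccontr)
    assume "s ! i \<noteq> t ! i"
    with that fin have "i \<le> j" unfolding j_def by (intro Max_ge) (auto simp: D_def)
    with that show False by simp
  qed
  have sum_eq: "(\<Sum>i\<in>{j<..<length s}. s ! i) = (\<Sum>i\<in>{j<..<length s}. t ! i)"
    using eq by (intro sum.cong) auto
  consider "s ! j < t ! j" | "t ! j < s ! j" using j by linarith
  thus ?thesis
  proof cases
    case 1
    show ?thesis
    proof (cases "even ((\<Sum>i\<in>{j<..<length s}. s ! i) + (length s - Suc j))")
      case True
      hence "t \<prec>\<^sub>c s" unfolding co_rgc_less_def
        using 1 j eq sum_eq assms(1) by (intro conjI exI[of _ j]) auto
      thus ?thesis ..
    next
      case False
      hence "s \<prec>\<^sub>c t" unfolding co_rgc_less_def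
        using 1 j eq assms(1) by (intro conjI exI[of _ j]) auto
      thus ?thesis ..
    qed
  next
    case 2
    show ?thesis
    proof (cases "even ((\<Sum>i\<in>{j<..<length s}. s ! i) + (length s - Suc j))")
      case True
      hence "s \<prec>\<^sub>c t" unfolding co_rgc_less_def
        using 2 j eq assms(1) by (intro conjI exI[of _ j]) auto
      thus ?thesis ..
    next
      case False
      hence "t \<prec>\<^sub>c s" unfolding co_rgc_less_def
        using 2 j eq sum_eq assms(1) by (intro conjI exI[of _ j]) auto
      thus ?thesis ..
    qed
  qed
qed

lemma finite_SE: "finite (SE n)"
proof (rule finite_subset)
  show "SE n \<subseteq> {s. set s \<subseteq> {..n} \<and> length s = n}"
  proof
    fix s assume s: "s \<in> SE n"
    have "s ! i \<le> n" if "i < n" for i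
    proof (cases "i = 0")
      case False
      hence "s ! i \<le> i" using s that by (auto simp: SE_def)
      thus ?thesis using that by linarith
    qed (use s in \<open>simp add: SE_def\<close>)
    thus "s \<in> {s. set s \<subseteq> {..n} \<and> length s = n}"
      using s by (auto simp: SE_def in_set_conv_nth)
  qed
  show "finite {s. set s \<subseteq> {..n} \<and> length s = n}"
    by (rule finite_lists_length_eq) simp
qed

lemma ex_listing:
  assumes "finite S"
    and irrefl: "\<And>x. \<not> r x x"
    and trans: "\<And>x y z. r x y \<Longrightarrow> r y z \<Longrightarrow> r x z"
    and total: "\<And>x y. x \<in> S \<Longrightarrow> y \<in> S \<Longrightarrow> x \<noteq> y \<Longrightarrow> r x y \<or> r y x"
  shows "\<exists>L. is_listing r S L"
  using assms(1) total
proof (induction S rule: finite_induct)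
  case empty
  show ?case by (auto simp: is_listing_def)
next
  case (insert a S)
  then obtain L where L: "set L = S" "distinct L" "sorted_wrt r L"
    by (auto simp: is_listing_def)
  have cmp: "r x a \<or> r a x" if "x \<in> S" for x
    using insert that by (metis insertCI)
  let ?L = "filter (\<lambda>x. r x a) L @ a # filter (\<lambda>x. r a x) L"
  have "set ?L = insert a S" using L(1) cmp by auto
  moreover have "distinct ?L" using L insert.hyps irrefl trans by auto
  moreover have "sorted_wrt r ?L" using L(3) trans
    by (auto simp: sorted_wrt_append sorted_wrt_filter)
  ultimately show ?case unfolding is_listing_def by blast
qed

lemma listing_unique:
  assumes irrefl: "\<And>x. \<not> r x x"
    and trans: "\<And>x y z. r x y \<Longrightarrow> r y z \<Longrightarrow> r x z"
  shows "is_listing r S L \<Longrightarrow> is_listing r S L' \<Longrightarrow> L = L'"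
proof (induction L arbitrary: S L')
  case Nil
  thus ?case by (simp add: is_listing_def)
next
  case (Cons a L)
  then obtain b M where L': "L' = b # M" by (cases L') (auto simp: is_listing_def)
  have S: "set (a # L) = set (b # M)" and *: "\<forall>x\<in>set L. r a x" "\<forall>x\<in>set M. r b x"
    using Cons.prems by (simp_all add: is_listing_def L')
  have "a = b"
  proof (rule ccontr)
    assume "a \<noteq> b"
    hence "a \<in> set M" "b \<in> set L" using S by auto
    with * irrefl trans show False by blast
  qed
  moreover have "is_listing r (set L) L" "is_listing r (set L) M"
    using Cons.prems S \<open>a = b\<close> by (auto simp: is_listing_def L')
  ultimately show ?case using Cons.IH L' by blast
qed

lemma ex1_co_rgc_listing_SE: "\<exists>!L. is_listing (\<prec>\<^sub>c) (SE n) L"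
proof -
  have "\<exists>L. is_listing (\<prec>\<^sub>c) (SE n) L"
    by (rule ex_listing[OF finite_SE co_rgc_less_irrefl co_rgc_less_trans co_rgc_less_total])
       (auto simp: SE_def)
  moreover have "L = L'" if "is_listing (\<prec>\<^sub>c) (SE n) L" "is_listing (\<prec>\<^sub>c) (SE n) L'" for L L'
    by (rule listing_unique[OF co_rgc_less_irrefl co_rgc_less_trans that])
  ultimately show ?thesis by blast
qed

end

theory Submission
  imports Defs
begin

text \<open>
  Suppose \<open>s \<prec>\<^sub>c t\<close> differ in two positions; let \<open>j\<close> be the rightmost one and \<open>i\<close> the next one to
  its left. If \<open>s\<^sub>j\<close> and \<open>t\<^sub>j\<close> are not adjacent integers, an intermediate value at position \<open>j\<close> gives
  a sequence strictly between \<open>s\<close> and \<open>t\<close>. Otherwise the parities governing position \<open>i\<close> are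
  opposite in \<open>s\<close> and \<open>t\<close>, so that copying entry \<open>i\<close> of one sequence into the other moves \<open>s\<close> up or
  \<open>t\<close> down, without affecting the comparison at \<open>j\<close>. Hence neighbours in the list
  differ in one position only.
\<close>

text \<open>The parity of this number fixes the direction in which entries at position
  \<open>j\<close> are compared by \<open>\<prec>\<^sub>c\<close>.\<close>

definition suffix_weight :: "nat list \<Rightarrow> nat \<Rightarrow> nat" where
  "suffix_weight s j = (\<Sum>i\<in>{j<..<length s}. s ! i) + (length s - Suc j)"

lemma co_rgc_less_iff:
  "s \<prec>\<^sub>c t \<longleftrightarrow> length s = length t \<and>
    (\<exists>j < length s. (\<forall>i. j < i \<and> i < length s \<longrightarrow> s ! i = t ! i) \<and>
      (if even (suffix_weight s j) then t ! j < s ! j else s ! j < t ! j))"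
  unfolding co_rgc_less_def suffix_weight_def by (auto split: if_splits)

lemma co_rgc_lessI:
  assumes "length s = length t" "j < length s"
    and "\<And>i. j < i \<Longrightarrow> i < length s \<Longrightarrow> s ! i = t ! i"
    and "if even (suffix_weight s j) then t ! j < s ! j else s ! j < t ! j"
  shows "s \<prec>\<^sub>c t"
  using assms unfolding co_rgc_less_iff by blast

text \<open>The weight at \<open>j\<close> reads neither entry \<open>j\<close> nor those to its
  left, so changing these preserves the direction of comparison at \<open>j\<close>.\<close>

lemma suffix_weight_cong:
  assumes "length s = length t"
    and "\<And>i. j < i \<Longrightarrow> i < length s \<Longrightarrow> s ! i = t ! i"
  shows "suffix_weight s j = suffix_weight t j"
  unfolding suffix_weight_def using assms by (auto intro!: sum.cong)

text \<open>The two sums share every term except the one at \<open>j\<close>. The additive form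
  avoids truncated subtraction; if the entries at \<open>j\<close> differ by one, it yields opposite
  parities at \<open>i\<close>.\<close>

lemma suffix_weight_differ_once:
  assumes len: "length s = length t" and j: "i < j" "j < length s"
    and eq: "\<And>k. i < k \<Longrightarrow> k < length s \<Longrightarrow> k \<noteq> j \<Longrightarrow> s ! k = t ! k"
  shows "suffix_weight s i + t ! j = suffix_weight t i + s ! j"
proof -
  have j_in: "j \<in> {i<..<length s}" using j by simp
  have "(\<Sum>k\<in>{i<..<length s} - {j}. s ! k) = (\<Sum>k\<in>{i<..<length s} - {j}. t ! k)"
    using eq by (intro sum.cong) auto
  thus ?thesis
    using sum.remove[OF _ j_in, of "(!) s"] sum.remove[OF _ j_in, of "(!) t"] len
    by (simp add: suffix_weight_def)
qed

text \<open>At \<open>i = 0\<close> the bound forces \<open>x = 0\<close>, so the condition on the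
  first entry needs no separate case.\<close>

lemma SE_list_update: "s \<in> SE n \<Longrightarrow> i < n \<Longrightarrow> x \<le> i \<Longrightarrow> s[i := x] \<in> SE n"
  by (auto simp: SE_def nth_list_update)

lemma SE_nth_le: "s \<in> SE n \<Longrightarrow> i < n \<Longrightarrow> s ! i \<le> i"
  by (cases "i = 0") (auto simp: SE_def)

lemma co_rgc_between:
  assumes s: "s \<in> SE n" and t: "t \<in> SE n" and less: "s \<prec>\<^sub>c t"
    and dist: "1 < hamming_dist s t"
  shows "\<exists>u\<in>SE n. s \<prec>\<^sub>c u \<and> u \<prec>\<^sub>c t"
proof -
  have len: "length s = n" "length t = n" using s t by (auto simp: SE_def)
  obtain j where j: "j < n" and eq: "\<And>i. j < i \<Longrightarrow> i < n \<Longrightarrow> s ! i = t ! i"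
    and cmp: "if even (suffix_weight s j) then t ! j < s ! j else s ! j < t ! j"
    using less len unfolding co_rgc_less_iff by auto
  have le: "s ! i \<le> i" "t ! i \<le> i" if "i < n" for i
    using SE_nth_le s t that by auto
  define D where "D = {i. i < j \<and> s ! i \<noteq> t ! i}"
  have "finite D" by (simp add: D_def)
  \<comment> \<open>Otherwise \<open>j\<close> would be the only position of difference, against
    \<open>dist\<close>.\<close>
  have "D \<noteq> {}"
  proof
    assume "D = {}"
    hence "s ! k = t ! k" if "k < n" "k \<noteq> j" for k
      using that eq unfolding D_def by (cases "k < j") auto
    hence "{i. i < length s \<and> s ! i \<noteq> t ! i} \<subseteq> {j}" using len by blast
    from card_mono[OF _ this] dist show False by (simp add: hamming_dist_def)
  qed
  define i where "i = Max D"
  have i: "i < j" "s ! i \<noteq> t ! i"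
    using Max_in[OF \<open>finite D\<close> \<open>D \<noteq> {}\<close>] by (auto simp: i_def D_def)
  have eq_i: "s ! k = t ! k" if "i < k" "k < n" "k \<noteq> j" for k
  proof (cases "k < j")
    case True
    have "k \<notin> D" using Max_ge[OF \<open>finite D\<close>] that(1) unfolding i_def by fastforce
    thus ?thesis using True by (simp add: D_def)
  next
    case False
    thus ?thesis using that eq by simp
  qed
  show ?thesis
  proof (cases "Suc (s ! j) < t ! j \<or> Suc (t ! j) < s ! j")
    case True
    \<comment> \<open>One above the smaller entry is strictly between the two whichever is larger,
      and stays below an entry that is at most \<open>j\<close>.\<close>
    define x where "x = Suc (min (s ! j) (t ! j))"
    have x: "s ! j < x \<and> x < t ! j \<or> t ! j < x \<and> x < s ! j"
      using True by (auto simp: x_def)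
    define u where "u = s[j := x]"
    have u: "length u = n" "u ! j = x" "\<And>k. k \<noteq> j \<Longrightarrow> u ! k = s ! k"
      using len j by (auto simp: u_def)
    have "u \<in> SE n" unfolding u_def using SE_list_update s j x le[OF j] by auto
    moreover have "suffix_weight u j = suffix_weight s j"
      using suffix_weight_cong u len by simp
    hence "u \<prec>\<^sub>c t"
      using x cmp j eq u len by (intro co_rgc_lessI[of _ _ j]) (auto split: if_splits)
    moreover have "s \<prec>\<^sub>c u"
      using x cmp j u len by (intro co_rgc_lessI[of _ _ j]) (auto split: if_splits)
    ultimately show ?thesis by blast
  next
    case False
    \<comment> \<open>\<open>cmp\<close> rules out equality, so the gap is exactly one.\<close>
    hence "s ! j = Suc (t ! j) \<or> t ! j = Suc (s ! j)"
      using cmp by (auto split: if_splits)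
    moreover have "suffix_weight s i + t ! j = suffix_weight t i + s ! j"
      using suffix_weight_differ_once i j eq_i len by simp
    ultimately have
      "suffix_weight s i = Suc (suffix_weight t i) \<or> suffix_weight t i = Suc (suffix_weight s i)"
      by auto
    hence par: "even (suffix_weight s i) \<longleftrightarrow> odd (suffix_weight t i)" by auto
    have in_SE: "s[i := t ! i] \<in> SE n" "t[i := s ! i] \<in> SE n"
      using SE_list_update s t i j le by auto
    show ?thesis
    proof (cases "if even (suffix_weight s i) then t ! i < s ! i else s ! i < t ! i")
      case True
      \<comment> \<open>\<open>u\<close> keeps entry \<open>j\<close> of \<open>s\<close>, so it
        still precedes \<open>t\<close> by the comparison at \<open>j\<close>, while
        \<open>s\<close> and \<open>u\<close> differ only at \<open>i\<close>.\<close>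
      define u where "u = s[i := t ! i]"
      have u: "length u = n" "u ! i = t ! i" "\<And>k. k \<noteq> i \<Longrightarrow> u ! k = s ! k"
        using len i j by (auto simp: u_def)
      have "suffix_weight u j = suffix_weight s j"
        using suffix_weight_cong u len i by simp
      hence "u \<prec>\<^sub>c t"
        using cmp j i eq u len by (intro co_rgc_lessI[of _ _ j]) auto
      moreover have "s \<prec>\<^sub>c u"
        using True i j u len by (intro co_rgc_lessI[of _ _ i]) auto
      ultimately show ?thesis using in_SE u_def by blast
    next
      case False
      \<comment> \<open>The entries at \<open>i\<close> differ, so the failed comparison holds in
        reverse; as \<open>t\<close> has the opposite parity at \<open>i\<close>, this is the
        comparison that puts \<open>u\<close> before \<open>t\<close>.\<close>
      define u where "u = t[i := s ! i]"
      have u: "length u = n" "u ! i = s ! i" "\<And>k. k \<noteq> i \<Longrightarrow> u ! k = t ! k"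
        using len i j by (auto simp: u_def)
      have "s \<prec>\<^sub>c u"
        using cmp j i eq u len by (intro co_rgc_lessI[of _ _ j]) auto
      moreover have "suffix_weight u i = suffix_weight t i"
        using suffix_weight_cong u len by simp
      hence "u \<prec>\<^sub>c t"
        using False par i j u len by (intro co_rgc_lessI[of _ _ i]) (auto split: if_splits)
      ultimately show ?thesis using in_SE u_def by blast
    qed
  qed
qed

text \<open>Any element of \<open>S\<close> occupies an index of \<open>L\<close>, and no index lies
  strictly between \<open>i\<close> and \<open>Suc i\<close>; every other place contradicts
  sortedness.\<close>

lemma listing_no_between:
  assumes listing: "is_listing r S L" and i: "Suc i < length L" and u: "u \<in> S"
    and irrefl: "\<And>x. \<not> r x x"
    and trans: "\<And>x y z. r x y \<Longrightarrow> r y z \<Longrightarrow> r x z"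
  shows "\<not> (r (L ! i) u \<and> r u (L ! Suc i))"
proof
  assume between: "r (L ! i) u \<and> r u (L ! Suc i)"
  obtain k where k: "k < length L" "u = L ! k"
    using listing u by (auto simp: is_listing_def in_set_conv_nth)
  have mono: "r (L ! a) (L ! b)" if "a < b" "b < length L" for a b
    using listing that by (auto simp: is_listing_def sorted_wrt_iff_nth_less)
  consider "k < i" | "k = i" | "k = Suc i" | "Suc i < k" by linarith
  thus False
  proof cases
    case 1
    thus False using mono[of k i] between k i irrefl trans by (meson Suc_lessD)
  next
    case 4
    thus False using mono[of "Suc i" k] between k irrefl trans by blast
  qed (use between k irrefl in auto)
qed

theorem theorem2:
  fixes n :: nat and L :: "nat list list"
  assumes "n \<ge> 1"
    and "is_listing (\<prec>\<^sub>c) (SE n) L"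
  shows "gray_code 1 L"
  unfolding gray_code_def successively_conv_nth
proof (intro allI impI)
  fix i assume i: "Suc i < length L"
  have in_SE: "L ! i \<in> SE n" "L ! Suc i \<in> SE n" and less: "L ! i \<prec>\<^sub>c L ! Suc i"
    using assms(2) i by (auto simp: is_listing_def sorted_wrt_iff_nth_less)
  show "hamming_dist (L ! i) (L ! Suc i) \<le> 1"
  proof (rule ccontr)
    assume "\<not> hamming_dist (L ! i) (L ! Suc i) \<le> 1"
    then obtain u where u: "u \<in> SE n" "L ! i \<prec>\<^sub>c u \<and> u \<prec>\<^sub>c L ! Suc i"
      using co_rgc_between[OF in_SE less] by auto
    have "\<not> (L ! i \<prec>\<^sub>c u \<and> u \<prec>\<^sub>c L ! Suc i)"
      by (rule listing_no_between[OF assms(2) i u(1)])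
        (fact co_rgc_less_irrefl, fact co_rgc_less_trans)
    with u(2) show False by blast
  qed
qed

end
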